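(* Let $q$ be a power of an odd prime, let $n\ge 2$, and let $\mathcal{K}\subseteq\mathbb{F}_q^n$ be a conical Kakeya set. Then $$|\mathcal{K}|\ge\left(\frac{q}{3}\right)^n.$$
   Context: For vectors $\underline{a},\underline{b},\underline{c}\in\mathbb{F}_q^n$ with $\underline{b},\underline{c}$ linearly independent, define a hyperbola $\mathcal{H}=\{\underline{a}+t\underline{b}+t^{-1}\underline{c}: t\in\mathbb{F}_q^*\}$ and a parabola $\mathcal{P}=\{\underline{a}+t\underline{b}+t^{2}\underline{c}: t\in\mathbb{F}_q\}$. A set $\mathcal{K}\subseteq\mathbb{F}_q^n$ is a conical Kakeya set if for every $\underline{d}\in\mathbb{F}_q^n\setminus\{\underline{0}\}$ there exist $\underline{a},\underline{b},\underline{c}\in\mathbb{F}_q^n$ with $\underline{b},\underline{c}$ linearly independent such that either the hyperbola $\mathcal{H}$ with $\underline{d}\in\{\underline{b},\underline{c}\}$ is contained in $\mathcal{K}$, or the parabola $\mathcal{P}$ with $\underline{d}=\underline{c}$ is contained in $\mathcal{K}$. *)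

theory Defs
  imports "HOL-Analysis.Analysis" "HOL-Computational_Algebra.Primes"
begin

(* The library's independence is a property of sets, so the family (b, c)
   is independent only if b \<noteq> c holds in addition. *)
definition lin_indep2 :: "('a::field) ^ 'n \<Rightarrow> 'a ^ 'n \<Rightarrow> bool" where
  "lin_indep2 b c \<longleftrightarrow> b \<noteq> c \<and> vec.independent {b, c}"

definition hyperbola :: "('a::field) ^ 'n \<Rightarrow> 'a ^ 'n \<Rightarrow> 'a ^ 'n \<Rightarrow> ('a ^ 'n) set" where
  "hyperbola a b c = {a + t *s b + inverse t *s c | t. t \<noteq> 0}"

definition parabola :: "('a::field) ^ 'n \<Rightarrow> 'a ^ 'n \<Rightarrow> 'a ^ 'n \<Rightarrow> ('a ^ 'n) set" where
  "parabola a b c = {a + t *s b + t\<^sup>2 *s c | t. True}"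

definition conical_Kakeya_set :: "(('a::field) ^ 'n) set \<Rightarrow> bool" where
  "conical_Kakeya_set K \<longleftrightarrow>
     (\<forall>d. d \<noteq> 0 \<longrightarrow>
       (\<exists>a b c. lin_indep2 b c \<and>
          (d \<in> {b, c} \<and> hyperbola a b c \<subseteq> K \<or> d = c \<and> parabola a b c \<subseteq> K)))"

end

theory Submission
  imports Defs
begin

text \<open>The method of multiplicities. If \<open>K\<close> is small, pigeonhole gives a nonzero polynomial \<open>P\<close> of
degree \<open>d < l q\<close> vanishing to order \<open>3 l\<close> on \<open>K\<close>. Restricting a Hasse derivative of \<open>P\<close> of order
\<open>w < l\<close> to a conic in \<open>K\<close> (and multiplying by \<open>t ^ (d - w)\<close> for a hyperbola) gives a univariate
polynomial of degree at most \<open>2 (d - w)\<close> with at least \<open>q - 1\<close> roots of multiplicity \<open>3 l - w\<close>,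
which must be zero. Its coefficient of degree \<open>2 (d - w)\<close> is the derivative of the leading form of
\<open>P\<close> at the direction of the conic, so the leading form vanishes to order \<open>l\<close> at every direction,
against the Schwartz--Zippel lemma with multiplicities. Comparing dimensions gives
\<open>|K| \<ge> binom (l q - 1 + n) n / binom (3 l - 1 + n) n\<close>, and \<open>l\<close> tends to infinity.\<close>

text \<open>A polynomial in the variables \<open>'n\<close> is a finitely supported coefficient function on exponents
\<open>'n \<Rightarrow> nat\<close>.\<close>

definition mdeg :: "('n::finite \<Rightarrow> nat) \<Rightarrow> nat" where
  "mdeg e = (\<Sum>j\<in>UNIV. e j)"

definition mon :: "('n::finite \<Rightarrow> 'b::comm_ring_1) \<Rightarrow> ('n \<Rightarrow> nat) \<Rightarrow> 'b" where
  "mon x e = (\<Prod>j\<in>UNIV. x j ^ e j)"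

definition exps :: "nat \<Rightarrow> ('n::finite \<Rightarrow> nat) set" where
  "exps d = {e. mdeg e \<le> d}"

definition mev :: "(('n::finite \<Rightarrow> nat) \<Rightarrow> 'a::comm_ring_1) \<Rightarrow> ('n \<Rightarrow> 'a) \<Rightarrow> 'a" where
  "mev c x = (\<Sum>e | c e \<noteq> 0. c e * mon x e)"

text \<open>The coefficient of \<open>y ^ i\<close> in \<open>P (x + y)\<close>, as a polynomial in
  \<open>x\<close>. Binomial coefficients stand in for iterated partial derivatives, whose factorial
  factors can vanish in positive characteristic.\<close>

definition hasse ::
  "('n::finite \<Rightarrow> nat) \<Rightarrow> (('n \<Rightarrow> nat) \<Rightarrow> 'a::comm_ring_1) \<Rightarrow> ('n \<Rightarrow> nat) \<Rightarrow> 'a" where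
  "hasse i c = (\<lambda>e. of_nat (\<Prod>j\<in>UNIV. (e j + i j) choose i j) * c (\<lambda>j. e j + i j))"

definition bounded_deg :: "nat \<Rightarrow> (('n::finite \<Rightarrow> nat) \<Rightarrow> 'a::zero) \<Rightarrow> bool" where
  "bounded_deg d c \<longleftrightarrow> (\<forall>e. c e \<noteq> 0 \<longrightarrow> mdeg e \<le> d)"

definition vanishes :: "nat \<Rightarrow> (('n::finite \<Rightarrow> nat) \<Rightarrow> 'a::comm_ring_1) \<Rightarrow> ('n \<Rightarrow> 'a) \<Rightarrow> bool" where
  "vanishes m c x \<longleftrightarrow> (\<forall>i. mdeg i < m \<longrightarrow> mev (hasse i c) x = 0)"

text \<open>The numerator \<open>z ^ d * P (g / z)\<close> of \<open>P\<close> along a rational curve: \<open>z = 1\<close> for parabolas and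
\<open>z = t\<close> for hyperbolas.\<close>

definition homog_comp ::
  "nat \<Rightarrow> (('n::finite \<Rightarrow> nat) \<Rightarrow> 'a::comm_ring_1) \<Rightarrow> 'a poly \<Rightarrow> ('n \<Rightarrow> 'a poly) \<Rightarrow> 'a poly" where
  "homog_comp d c z g = (\<Sum>e\<in>exps d. smult (c e) (z ^ (d - mdeg e) * mon g e))"

definition top_form :: "nat \<Rightarrow> (('n::finite \<Rightarrow> nat) \<Rightarrow> 'a::zero) \<Rightarrow> ('n \<Rightarrow> nat) \<Rightarrow> 'a" where
  "top_form d c = (\<lambda>e. if mdeg e = d then c e else 0)"

section \<open>Degrees, evaluation and composition of Hasse derivatives\<close>

lemma mdeg_add: "mdeg (\<lambda>j. e j + i j) = mdeg e + mdeg i"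
  by (simp add: mdeg_def sum.distrib)

lemma mdeg_mono: "(\<And>j. i j \<le> e j) \<Longrightarrow> mdeg i \<le> mdeg e"
  by (simp add: mdeg_def sum_mono)

lemma mdeg_eq_0_iff: "mdeg e = 0 \<longleftrightarrow> e = (\<lambda>_. 0)"
  by (auto simp: mdeg_def)

lemma le_mdeg: "e j \<le> mdeg e"
  unfolding mdeg_def by (rule member_le_sum) auto

lemma finite_exps [simp]: "finite (exps d)"
proof (rule finite_subset)
  show "exps d \<subseteq> PiE UNIV (\<lambda>_. {..d})"
    by (auto simp: exps_def intro: order_trans[OF le_mdeg])
qed (auto intro: finite_PiE)

lemma mev_eq:
  assumes "finite A" "\<And>e. c e \<noteq> 0 \<Longrightarrow> e \<in> A"
  shows "mev c x = (\<Sum>e\<in>A. c e * mon x e)"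
  unfolding mev_def by (rule sum.mono_neutral_left) (use assms in auto)

lemma mev_bounded:
  assumes "bounded_deg d c" shows "mev c x = (\<Sum>e\<in>exps d. c e * mon x e)"
proof (rule mev_eq)
  show "e \<in> exps d" if "c e \<noteq> 0" for e
    using that assms by (simp add: exps_def bounded_deg_def)
qed simp

lemma bounded_deg_mono: "bounded_deg d c \<Longrightarrow> d \<le> d' \<Longrightarrow> bounded_deg d' c"
  by (auto simp: bounded_deg_def intro: order_trans)

lemma bounded_deg_hasse:
  assumes "bounded_deg d c" shows "bounded_deg (d - mdeg i) (hasse i c)"
proof -
  have "mdeg e \<le> d - mdeg i" if "hasse i c e \<noteq> 0" for e
  proof -
    have "c (\<lambda>j. e j + i j) \<noteq> 0" using that by (auto simp: hasse_def)
    then have "mdeg e + mdeg i \<le> d" using assms mdeg_add[of e i] by (auto simp: bounded_deg_def)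
    then show ?thesis by simp
  qed
  then show ?thesis by (auto simp: bounded_deg_def)
qed

lemma bounded_deg_top_form: "bounded_deg d (top_form d c)"
  by (auto simp: bounded_deg_def top_form_def)

lemma hasse_0 [simp]: "hasse (\<lambda>_. 0) c = c"
  by (simp add: hasse_def)

text \<open>In each coordinate both sides are one trinomial coefficient, for splitting
  \<open>e j + i j + k j\<close> into three parts, factored in two ways.\<close>

lemma hasse_hasse:
  "hasse i (hasse k c) =
     (\<lambda>e. of_nat (\<Prod>j\<in>UNIV. (i j + k j) choose i j) * hasse (\<lambda>j. i j + k j) c e)"
proof
  fix e
  have *: "((e j + i j) choose i j) * ((e j + i j + k j) choose k j) =
      ((i j + k j) choose i j) * ((e j + (i j + k j)) choose (i j + k j))" for j
  proof -
    have "((e j + i j + k j) choose (i j + k j)) * ((i j + k j) choose k j)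
        = ((e j + i j + k j) choose k j) * ((e j + i j + k j - k j) choose (i j + k j - k j))"
      by (rule choose_mult) auto
    moreover have "(i j + k j) choose k j = (i j + k j) choose i j"
      using binomial_symmetric[of "k j" "i j + k j"] by simp
    ultimately show ?thesis by (simp add: algebra_simps)
  qed
  show "hasse i (hasse k c) e =
      of_nat (\<Prod>j\<in>UNIV. (i j + k j) choose i j) * hasse (\<lambda>j. i j + k j) c e"
    unfolding hasse_def of_nat_mult[symmetric] mult.assoc[symmetric] prod.distrib[symmetric] *
    by (simp add: add.assoc)
qed

lemma mev_scale:
  assumes "bounded_deg d c" shows "mev (\<lambda>e. r * c e) x = r * mev c x"
proof -
  have "bounded_deg d (\<lambda>e. r * c e)"
    using assms unfolding bounded_deg_def by (metis mult_zero_right)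
  then show ?thesis
    using assms by (simp add: mev_bounded sum_distrib_left mult.assoc)
qed

lemma mev_hasse_hasse:
  assumes "bounded_deg d c"
  shows "mev (hasse i (hasse k c)) x =
    of_nat (\<Prod>j\<in>UNIV. (i j + k j) choose i j) * mev (hasse (\<lambda>j. i j + k j) c) x"
  unfolding hasse_hasse by (rule mev_scale[OF bounded_deg_hasse[OF assms]])

text \<open>Composing with a derivative of order below \<open>m - mdeg i\<close> gives, up to a
  scalar, a derivative of \<open>c\<close> of order below \<open>m\<close>.\<close>

lemma vanishes_hasse:
  assumes "bounded_deg d c" "vanishes m c x"
  shows "vanishes (m - mdeg i) (hasse i c) x"
  using assms by (auto simp: vanishes_def mev_hasse_hasse mdeg_add)

section \<open>Taylor expansion along a rational curve\<close>

lemma mon_add_expand: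
  fixes x y :: "'n::finite \<Rightarrow> 'b::comm_ring_1"
  shows "mon (\<lambda>j. x j + y j) e =
    (\<Sum>i | \<forall>j. i j \<le> e j. of_nat (\<Prod>j\<in>UNIV. e j choose i j) * mon x (\<lambda>j. e j - i j) * mon y i)"
proof -
  have "mon (\<lambda>j. x j + y j) e = (\<Prod>j\<in>UNIV. \<Sum>k\<le>e j. of_nat (e j choose k) * y j ^ k * x j ^ (e j - k))"
    unfolding mon_def by (subst binomial_ring[symmetric]) (simp add: add.commute)
  also have "\<dots> = (\<Sum>i\<in>PiE UNIV (\<lambda>j. {..e j}).
      \<Prod>j\<in>UNIV. of_nat (e j choose i j) * y j ^ i j * x j ^ (e j - i j))"
    by (rule prod_sum_PiE) auto
  also have "PiE UNIV (\<lambda>j. {..e j}) = {i. \<forall>j. i j \<le> e j}"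
    by (auto simp: PiE_def)
  finally show ?thesis
    by (simp add: mon_def prod.distrib mult_ac)
qed

text \<open>Substitute \<open>e = f + i\<close>: the pairs with \<open>i\<close> below
  \<open>e\<close> become pairs with \<open>f\<close> of degree at most \<open>d - mdeg i\<close>,
  so terms can be collected by \<open>i\<close>.\<close>

lemma sum_exps_swap:
  fixes F :: "('n::finite \<Rightarrow> nat) \<Rightarrow> ('n \<Rightarrow> nat) \<Rightarrow> 'b::comm_monoid_add"
  shows "(\<Sum>e\<in>exps d. \<Sum>i | \<forall>j. i j \<le> e j. F e i) =
    (\<Sum>i\<in>exps d. \<Sum>f\<in>exps (d - mdeg i). F (\<lambda>j. f j + i j) i)"
proof -
  have fin: "finite {i. \<forall>j. i j \<le> e j}" for e :: "'n \<Rightarrow> nat"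
    by (rule finite_subset[OF _ finite_exps[of "mdeg e"]]) (auto simp: exps_def intro: mdeg_mono)
  have "(\<Sum>e\<in>exps d. \<Sum>i | \<forall>j. i j \<le> e j. F e i) =
      (\<Sum>(e, i)\<in>Sigma (exps d) (\<lambda>e. {i. \<forall>j. i j \<le> e j}). F e i)"
    by (rule sum.Sigma) (use fin in auto)
  also have "\<dots> = (\<Sum>(i, f)\<in>Sigma (exps d) (\<lambda>i. exps (d - mdeg i)). F (\<lambda>j. f j + i j) i)"
  proof (rule sum.reindex_bij_witness
      [where i = "\<lambda>(i, f). (\<lambda>j. f j + i j, i)" and j = "\<lambda>(e, i). (i, \<lambda>j. e j - i j)"])
    fix a assume "a \<in> Sigma (exps d) (\<lambda>e. {i. \<forall>j. i j \<le> e j})"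
    then obtain e i where a: "a = (e, i)" "mdeg e \<le> d" "\<And>j. i j \<le> e j"
      by (auto simp: exps_def)
    have "mdeg (\<lambda>j. e j - i j) + mdeg i = mdeg e"
      using mdeg_add[of "\<lambda>j. e j - i j" i] a(3) by simp
    then show "(case a of (e, i) \<Rightarrow> (i, \<lambda>j. e j - i j)) \<in> Sigma (exps d) (\<lambda>i. exps (d - mdeg i))"
      using a by (auto simp: exps_def)
  qed (auto simp: exps_def mdeg_add)
  also have "\<dots> = (\<Sum>i\<in>exps d. \<Sum>f\<in>exps (d - mdeg i). F (\<lambda>j. f j + i j) i)"
    by (rule sum.Sigma[symmetric]) auto
  finally show ?thesis .
qed

lemma prod_const_poly: "(\<Prod>j\<in>A. [:f j:]) = [:\<Prod>j\<in>A. f j:]"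
  by (induction A rule: infinite_finite_induct) (auto simp: one_pCons mult.commute)

lemma mon_mult_const:
  "mon (\<lambda>j. z * [:x j:]) e = z ^ mdeg e * [:mon x e:]"
  unfolding mon_def power_mult_distrib prod.distrib mdeg_def power_sum poly_const_pow prod_const_poly ..

lemma smult_sum_right: "smult a (\<Sum>i\<in>A. f i) = (\<Sum>i\<in>A. smult a (f i))"
  by (induction A rule: infinite_finite_induct) (auto simp: smult_add_right)

text \<open>This is the Taylor expansion of \<open>P (x + y / z)\<close> at the constant point
  \<open>x\<close>, with denominators cleared by \<open>z ^ d\<close>: expand each monomial by the
  binomial theorem and collect by \<open>i\<close>.\<close>

lemma homog_comp_taylor:
  fixes x :: "'n::finite \<Rightarrow> 'a::comm_ring_1"
  assumes "bounded_deg d c"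
  shows "homog_comp d c z (\<lambda>j. z * [:x j:] + y j) =
    (\<Sum>i\<in>exps d. smult (mev (hasse i c) x) (z ^ (d - mdeg i) * mon y i))"
proof -
  have "homog_comp d c z (\<lambda>j. z * [:x j:] + y j) =
    (\<Sum>e\<in>exps d. \<Sum>i | \<forall>j. i j \<le> e j. smult (c e) (z ^ (d - mdeg e) *
       (of_nat (\<Prod>j\<in>UNIV. e j choose i j) * mon (\<lambda>j. z * [:x j:]) (\<lambda>j. e j - i j) * mon y i)))"
    unfolding homog_comp_def mon_add_expand by (simp add: sum_distrib_left smult_sum_right)
  also have "\<dots> = (\<Sum>i\<in>exps d. \<Sum>f\<in>exps (d - mdeg i).
      smult (c (\<lambda>j. f j + i j)) (z ^ (d - mdeg (\<lambda>j. f j + i j)) *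
       (of_nat (\<Prod>j\<in>UNIV. (f j + i j) choose i j) * mon (\<lambda>j. z * [:x j:]) f * mon y i)))"
    unfolding sum_exps_swap by simp
  also have "\<dots> = (\<Sum>i\<in>exps d. \<Sum>f\<in>exps (d - mdeg i).
      smult (hasse i c f * mon x f) (z ^ (d - mdeg i) * mon y i))"
  proof (intro sum.cong refl)
    fix i f :: "'n \<Rightarrow> nat" assume "i \<in> exps d" "f \<in> exps (d - mdeg i)"
    then have "z ^ (d - mdeg i) = z ^ (d - mdeg (\<lambda>j. f j + i j)) * z ^ mdeg f"
      by (simp add: exps_def mdeg_add flip: power_add)
    moreover have "of_nat (\<Prod>j\<in>UNIV. (f j + i j) choose i j) =
        [:of_nat (\<Prod>j\<in>UNIV. (f j + i j) choose i j) :: 'a:]"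
      by (simp only: of_nat_poly)
    ultimately show "smult (c (\<lambda>j. f j + i j)) (z ^ (d - mdeg (\<lambda>j. f j + i j)) *
       (of_nat (\<Prod>j\<in>UNIV. (f j + i j) choose i j) * mon (\<lambda>j. z * [:x j:]) f * mon y i)) =
       smult (hasse i c f * mon x f) (z ^ (d - mdeg i) * mon y i)"
      unfolding mon_mult_const hasse_def by (simp add: mult_ac del: of_nat_prod)
  qed
  also have "\<dots> = (\<Sum>i\<in>exps d. smult (mev (hasse i c) x) (z ^ (d - mdeg i) * mon y i))"
    by (simp add: mev_bounded[OF bounded_deg_hasse[OF assms]] smult_sum)
  finally show ?thesis .
qed

text \<open>Expand at the point \<open>x\<close> of the curve with parameter \<open>t\<close>. Terms
  with \<open>mdeg i < m\<close> vanish by hypothesis; in the others each increment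
  \<open>y j\<close> has the root \<open>t\<close>, which gives at least \<open>m\<close> linear
  factors.\<close>

lemma homog_comp_dvd:
  fixes c :: "('n::finite \<Rightarrow> nat) \<Rightarrow> 'a::field"
  assumes "bounded_deg d c" "poly z t \<noteq> 0" "vanishes m c (\<lambda>j. poly (g j) t / poly z t)"
  shows "[:-t, 1:] ^ m dvd homog_comp d c z g"
proof -
  define x where "x = (\<lambda>j. poly (g j) t / poly z t)"
  define y where "y = (\<lambda>j. g j - z * [:x j:])"
  have y: "[:-t, 1:] dvd y j" for j
    using assms(2) by (simp add: y_def x_def flip: poly_eq_0_iff_dvd)
  have *: "[:-t, 1:] ^ mdeg i dvd mon y i" for i
    unfolding mdeg_def mon_def power_sum by (intro prod_dvd_prod dvd_power_same y)
  have "homog_comp d c z g = homog_comp d c z (\<lambda>j. z * [:x j:] + y j)"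
    by (simp add: y_def)
  also have "\<dots> = (\<Sum>i\<in>exps d. smult (mev (hasse i c) x) (z ^ (d - mdeg i) * mon y i))"
    by (rule homog_comp_taylor[OF assms(1)])
  also have "[:-t, 1:] ^ m dvd \<dots>"
  proof (rule dvd_sum)
    fix i
    show "[:-t, 1:] ^ m dvd smult (mev (hasse i c) x) (z ^ (d - mdeg i) * mon y i)"
    proof (cases "mdeg i < m")
      case True
      then show ?thesis using assms(3) by (simp add: vanishes_def x_def)
    next
      case False
      then have "[:-t, 1:] ^ m dvd mon y i"
        by (meson * dvd_trans le_imp_power_dvd not_less)
      then show ?thesis by (intro dvd_smult dvd_mult)
    qed
  qed
  finally show ?thesis .
qed

section \<open>Root counting with multiplicity\<close>

lemma linear_powers_dvd_imp_zero:
  fixes f :: "'a::field poly"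
  assumes "finite T" "\<And>t. t \<in> T \<Longrightarrow> [:-t, 1:] ^ m dvd f" "degree f < m * card T"
  shows "f = 0"
proof (rule ccontr)
  assume "f \<noteq> 0"
  have ord: "m \<le> order t f" if "t \<in> T" for t
    using assms(2)[OF that] \<open>f \<noteq> 0\<close> by (simp add: order_divides)
  have "m > 0" using assms(3) by (cases m) auto
  then have "T \<subseteq> {t. poly f t = 0}"
    using ord \<open>f \<noteq> 0\<close> by (fastforce simp: order_root)
  then have "(\<Sum>t\<in>T. order t f) \<le> (\<Sum>t | poly f t = 0. order t f)"
    by (intro sum_mono2) (auto simp: poly_roots_finite \<open>f \<noteq> 0\<close>)
  also have "\<dots> \<le> degree f" by (rule sum_order_le_degree[OF \<open>f \<noteq> 0\<close>])
  finally have "(\<Sum>t\<in>T. order t f) \<le> degree f" .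
  moreover have "(\<Sum>t\<in>T. m) \<le> (\<Sum>t\<in>T. order t f)" by (intro sum_mono ord)
  ultimately show False using assms(3) by (simp add: mult.commute)
qed

lemma homog_comp_eq_0:
  fixes c :: "('n::finite \<Rightarrow> nat) \<Rightarrow> 'a::field"
  assumes "bounded_deg d c" "finite T" "\<And>t. t \<in> T \<Longrightarrow> poly z t \<noteq> 0"
    and "\<And>t. t \<in> T \<Longrightarrow> vanishes m c (\<lambda>j. poly (g j) t / poly z t)"
    and "degree (homog_comp d c z g) < m * card T"
  shows "homog_comp d c z g = 0"
  using assms by (intro linear_powers_dvd_imp_zero[of T m] homog_comp_dvd) auto

section \<open>The Schwartz--Zippel lemma with multiplicities\<close>

lemma mdeg_fun_upd: "e k = 0 \<Longrightarrow> mdeg (e(k := t)) = mdeg e + t"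
proof -
  assume "e k = 0"
  then have "e(k := t) = (\<lambda>j. e j + ((\<lambda>_. 0)(k := t)) j)" by auto
  then have "mdeg (e(k := t)) = mdeg e + mdeg ((\<lambda>_. 0)(k := t))" by (metis mdeg_add)
  moreover have "mdeg ((\<lambda>_. 0)(k := t)) = t" by (simp add: mdeg_def)
  ultimately show ?thesis by simp
qed

lemma mon_line:
  fixes x :: "'n::finite \<Rightarrow> 'a::comm_ring_1"
  shows "mon (\<lambda>j. if j = k then [:0, 1:] else [:x j:]) e = monom (\<Prod>j\<in>-{k}. x j ^ e j) (e k)"
proof -
  let ?g = "\<lambda>j. if j = k then [:0, 1:] else [:x j:]"
  have "UNIV = insert k (-{k})" by auto
  then have "mon ?g e = (\<Prod>j\<in>insert k (-{k}). ?g j ^ e j)"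
    by (simp add: mon_def)
  also have "\<dots> = [:0, 1:] ^ e k * (\<Prod>j\<in>-{k}. ?g j ^ e j)"
    by (subst prod.insert) auto
  also have "(\<Prod>j\<in>-{k}. ?g j ^ e j) = (\<Prod>j\<in>-{k}. [:x j ^ e j:])"
    by (intro prod.cong) (auto simp: poly_const_pow)
  also have "\<dots> = [:\<Prod>j\<in>-{k}. x j ^ e j:]"
    by (rule prod_const_poly)
  finally show ?thesis by (simp add: monom_altdef)
qed

text \<open>Induction on the set \<open>S\<close> of variables that may occur, within the fixed
  index type. The leading coefficient in one variable \<open>k\<close> has a nonvanishing derivative
  by induction; restricting to a line in direction \<open>k\<close> then reduces to univariate root
  counting.\<close>

lemma schwartz_zippel_multiplicity:
  fixes c :: "('n::finite \<Rightarrow> nat) \<Rightarrow> 'a::{field,finite}"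
  assumes "finite S" "bounded_deg d c" "\<exists>e. c e \<noteq> 0" "\<And>e j. c e \<noteq> 0 \<Longrightarrow> j \<notin> S \<Longrightarrow> e j = 0"
  shows "\<exists>x i. mev (hasse i c) x \<noteq> 0 \<and> CARD('a) * mdeg i \<le> d"
  using assms
proof (induction S arbitrary: c d rule: finite_induct)
  case empty
  then have *: "e = (\<lambda>_. 0)" if "c e \<noteq> 0" for e using that by auto
  then have "mev c (\<lambda>_. 0) = (\<Sum>e\<in>{\<lambda>_. 0}. c e * mon (\<lambda>_. 0) e)"
    by (intro mev_eq) auto
  also have "\<dots> = c (\<lambda>_. 0)" by (simp add: mon_def)
  finally have "mev (hasse (\<lambda>_. 0) c) (\<lambda>_. 0) \<noteq> 0" using empty(2) * by auto
  moreover have "mdeg (\<lambda>_::'n. 0) = 0" by (simp add: mdeg_eq_0_iff)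
  ultimately show ?case by (metis mult_0_right zero_le)
next
  case (insert k S)
  let ?E = "{e. c e \<noteq> 0}"
  have "finite ?E"
    by (rule finite_subset[OF _ finite_exps[of d]])
      (use insert.prems(1) in \<open>auto simp: bounded_deg_def exps_def\<close>)
  define t where "t = Max ((\<lambda>e. e k) ` ?E)"
  have t_max: "e k \<le> t" if "c e \<noteq> 0" for e
    unfolding t_def by (rule Max_ge) (use \<open>finite ?E\<close> that in auto)
  have "t \<in> (\<lambda>e. e k) ` ?E"
    unfolding t_def by (rule Max_in) (use \<open>finite ?E\<close> insert.prems(2) in auto)
  then obtain e0 where e0: "c e0 \<noteq> 0" "e0 k = t" by auto
  have "t \<le> d"
    using e0 le_mdeg[of e0 k] insert.prems(1) by (force simp: bounded_deg_def)
  \<comment> \<open>The coefficient of the highest power \<open>t\<close> of variable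
    \<open>k\<close>, as a polynomial in the variables of \<open>S\<close>.\<close>
  define c' where "c' = (\<lambda>e. if e k = 0 then c (e(k := t)) else 0)"
  have bd': "bounded_deg (d - t) c'"
    unfolding bounded_deg_def
  proof safe
    fix e assume "c' e \<noteq> 0"
    then have "e k = 0" "c (e(k := t)) \<noteq> 0" by (auto simp: c'_def split: if_splits)
    then show "mdeg e \<le> d - t"
      using insert.prems(1) by (fastforce simp: bounded_deg_def mdeg_fun_upd)
  qed
  have "\<exists>x i. mev (hasse i c') x \<noteq> 0 \<and> CARD('a) * mdeg i \<le> d - t"
  proof (rule insert.IH[OF bd'])
    have "c' (e0(k := 0)) \<noteq> 0" using e0 by (auto simp: c'_def)
    then show "\<exists>e. c' e \<noteq> 0" by blast
    show "e j = 0" if "c' e \<noteq> 0" "j \<notin> S" for e j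
    proof (cases "j = k")
      case True
      then show ?thesis using that by (auto simp: c'_def split: if_splits)
    next
      case False
      then have "c (e(k := t)) \<noteq> 0" "j \<notin> insert k S"
        using that by (auto simp: c'_def split: if_splits)
      then have "(e(k := t)) j = 0" by (rule insert.prems(3))
      then show ?thesis using False by simp
    qed
  qed
  then obtain x i where xi: "mev (hasse i c') x \<noteq> 0" "CARD('a) * mdeg i \<le> d - t" by blast
  \<comment> \<open>Since \<open>c'\<close> is free of variable \<open>k\<close>, differentiating in
    it would give zero. Hence the derivative \<open>i\<close> commutes with extracting the
    coefficient of power \<open>t\<close> of that variable.\<close>
  have "i k = 0"
  proof (rule ccontr)
    assume "i k \<noteq> 0"
    then have "hasse i c' = (\<lambda>_. 0)" by (auto simp: hasse_def c'_def)
    then show False using xi(1) by (simp add: mev_def)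
  qed
  define c2 where "c2 = hasse i c"
  have bd2: "bounded_deg d c2"
    unfolding c2_def by (rule bounded_deg_mono[OF bounded_deg_hasse[OF insert.prems(1)]]) simp
  define g where "g = (\<lambda>j. if j = k then [:0, 1:] else [:x j:])"
  define h where "h = homog_comp d c2 1 g"
  have h: "h = (\<Sum>e\<in>exps d. monom (c2 e * (\<Prod>j\<in>-{k}. x j ^ e j)) (e k))"
    by (simp add: h_def homog_comp_def g_def mon_line smult_monom)
  have "degree h \<le> t"
    unfolding h
  proof (rule degree_sum_le)
    fix e
    show "degree (monom (c2 e * (\<Prod>j\<in>-{k}. x j ^ e j)) (e k)) \<le> t"
    proof (cases "c2 e = 0")
      case False
      then have "c (\<lambda>j. e j + i j) \<noteq> 0" by (auto simp: c2_def hasse_def)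
      from t_max[OF this] show ?thesis
        by (intro order_trans[OF degree_monom_le]) simp
    qed simp
  qed simp
  have "mev (hasse i c') x = (\<Sum>f\<in>exps (d - t). hasse i c' f * mon x f)"
    by (rule mev_bounded) (use bounded_deg_mono[OF bounded_deg_hasse[OF bd']] in auto)
  also have "\<dots> = (\<Sum>f\<in>{f\<in>exps (d - t). f k = 0}. hasse i c' f * mon x f)"
    by (rule sum.mono_neutral_right) (auto simp: hasse_def c'_def)
  \<comment> \<open>Restoring the exponent \<open>t\<close> at \<open>k\<close> identifies the value
    of the derivative of \<open>c'\<close> with the coefficient of degree \<open>t\<close> of
    \<open>h\<close>.\<close>
  also have "\<dots> = (\<Sum>e\<in>{e\<in>exps d. e k = t}. c2 e * (\<Prod>j\<in>-{k}. x j ^ e j))"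
  proof (rule sum.reindex_bij_witness[where i = "\<lambda>e. e(k := 0)" and j = "\<lambda>f. f(k := t)"])
    fix f assume f: "f \<in> {f \<in> exps (d - t). f k = 0}"
    then show "f(k := t) \<in> {e \<in> exps d. e k = t}"
      using \<open>t \<le> d\<close> by (auto simp: exps_def mdeg_fun_upd)
    have "(\<Prod>j\<in>UNIV. ((f(k := t)) j + i j) choose i j) = (\<Prod>j\<in>UNIV. (f j + i j) choose i j)"
      by (intro prod.cong) (auto simp: \<open>i k = 0\<close>)
    moreover have "(\<lambda>j. (f(k := t)) j + i j) = (\<lambda>j. f j + i j)(k := t)"
      by (auto simp: \<open>i k = 0\<close>)
    ultimately have "c2 (f(k := t)) = hasse i c' f"
      using f by (simp add: c2_def hasse_def c'_def \<open>i k = 0\<close> del: of_nat_prod fun_upd_apply)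
    moreover have "mon x f = (\<Prod>j\<in>-{k}. x j ^ f j)"
      using f unfolding mon_def by (intro prod.mono_neutral_right) auto
    ultimately show "c2 (f(k := t)) * (\<Prod>j\<in>-{k}. x j ^ (f(k := t)) j) = hasse i c' f * mon x f"
      by simp
  next
    fix e assume e: "e \<in> {e \<in> exps d. e k = t}"
    then have "mdeg e = mdeg (e(k := 0)) + t"
      using mdeg_fun_upd[of "e(k := 0)" k t] by (auto simp: fun_upd_idem)
    then show "e(k := 0) \<in> {f \<in> exps (d - t). f k = 0}"
      using e by (auto simp: exps_def)
  qed (auto simp: fun_upd_idem)
  also have "\<dots> = coeff h t"
    unfolding h coeff_sum coeff_monom by (intro sum.mono_neutral_cong_left) auto
  finally have "h \<noteq> 0" using xi(1) by auto
  \<comment> \<open>The least \<open>m\<close> with \<open>t < m * CARD('a)\<close>: a nonzero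
    \<open>h\<close> of degree at most \<open>t\<close> cannot vanish to order \<open>m\<close> at
    every field element. The extra order is thus at most \<open>t div CARD('a)\<close>, which adds
    to the bound for \<open>i\<close> without exceeding \<open>d\<close>.\<close>
  define m where "m = t div CARD('a) + 1"
  have "t < m * CARD('a)"
    unfolding m_def using dividend_less_div_times[of "CARD('a)" t] by (simp add: add.commute)
  then have "\<not> (\<forall>a. vanishes m c2 (\<lambda>j. poly (g j) a / poly 1 a))"
    using homog_comp_eq_0[OF bd2, of UNIV 1 m g] \<open>degree h \<le> t\<close> \<open>h \<noteq> 0\<close> by (auto simp: h_def)
  then obtain a i2 where i2: "mdeg i2 < m" "mev (hasse i2 c2) (\<lambda>j. poly (g j) a / poly 1 a) \<noteq> 0"
    by (auto simp: vanishes_def)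
  have "CARD('a) * mdeg i2 \<le> CARD('a) * (t div CARD('a))"
    using i2(1) by (intro mult_le_mono2) (simp add: m_def)
  also have "\<dots> \<le> t" by simp
  finally have "CARD('a) * mdeg (\<lambda>j. i2 j + i j) \<le> d"
    using xi(2) \<open>t \<le> d\<close> by (simp add: mdeg_add distrib_left)
  \<comment> \<open>The composite derivative is a scalar multiple of this one, so its nonzero value
    forces a nonzero value here.\<close>
  moreover have "mev (hasse (\<lambda>j. i2 j + i j) c) (\<lambda>j. poly (g j) a / poly 1 a) \<noteq> 0"
    using i2(2) unfolding c2_def mev_hasse_hasse[OF insert.prems(1)] by auto
  ultimately show ?case by blast
qed

section \<open>Counting monomials and interpolating with multiplicity\<close>

lemma sum_choose_const: "(\<Sum>w\<le>d. (w + s) choose s) = (d + Suc s) choose Suc s"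
  by (induction d) auto

text \<open>Fixing the exponent \<open>v\<close> of a new variable leaves degree
  \<open>d - v\<close> for the others; the counts add up by the hockey-stick identity.\<close>

lemma card_exps_support:
  fixes S :: "'n::finite set"
  assumes "finite S"
  shows "card {e \<in> exps d. \<forall>j. j \<notin> S \<longrightarrow> e j = 0} = (d + card S) choose card S"
  using assms
proof (induction S arbitrary: d rule: finite_induct)
  case empty
  have "{e \<in> exps d. \<forall>j. j \<notin> {} \<longrightarrow> e j = 0} = {\<lambda>_::'n. 0::nat}"
    by (auto simp: exps_def mdeg_def)
  then show ?case by simp
next
  case (insert k S)
  let ?A = "\<lambda>S d. {e \<in> exps d. \<forall>j. j \<notin> S \<longrightarrow> e j = 0}"
  have "?A (insert k S) d = (\<Union>v\<in>{..d}. (\<lambda>e. e(k := v)) ` ?A S (d - v))"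
  proof (intro equalityI subsetI)
    fix e assume e: "e \<in> ?A (insert k S) d"
    have "mdeg e = mdeg (e(k := 0)) + e k"
      using mdeg_fun_upd[of "e(k := 0)" k "e k"] by simp
    then have "e k \<le> d" "e(k := 0) \<in> ?A S (d - e k)"
      using e by (auto simp: exps_def)
    moreover have "e = (e(k := 0))(k := e k)" by simp
    ultimately show "e \<in> (\<Union>v\<in>{..d}. (\<lambda>e. e(k := v)) ` ?A S (d - v))" by blast
  qed (use insert.hyps in \<open>auto simp: exps_def mdeg_fun_upd\<close>)
  also have "card \<dots> = (\<Sum>v\<le>d. card ((\<lambda>e. e(k := v)) ` ?A S (d - v)))"
  proof (rule card_UN_disjoint)
    have "(\<lambda>e. e(k := v)) ` ?A S (d - v) \<inter> (\<lambda>e. e(k := w)) ` ?A S (d - w) = {}"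
      if "v \<noteq> w" for v w
      using that by (auto dest: fun_cong[of _ _ k])
    then show "\<forall>v\<in>{..d}. \<forall>w\<in>{..d}. v \<noteq> w \<longrightarrow>
        (\<lambda>e. e(k := v)) ` ?A S (d - v) \<inter> (\<lambda>e. e(k := w)) ` ?A S (d - w) = {}"
      by blast
  qed auto
  also have "\<dots> = (\<Sum>v\<le>d. (d - v + card S) choose card S)"
  proof (rule sum.cong[OF refl])
    fix v
    have "inj_on (\<lambda>e. e(k := v)) (?A S (d - v))"
    proof (rule inj_onI)
      fix e f assume ef: "e \<in> ?A S (d - v)" "f \<in> ?A S (d - v)" "e(k := v) = f(k := v)"
      have "e k = 0" "f k = 0" using ef insert.hyps by auto
      then show "e = f" using ef(3) by (metis fun_upd_triv fun_upd_upd)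
    qed
    then show "card ((\<lambda>e. e(k := v)) ` ?A S (d - v)) = (d - v + card S) choose card S"
      by (simp add: card_image insert.IH)
  qed
  also have "\<dots> = (\<Sum>w\<le>d. (w + card S) choose card S)"
    by (rule sum.reindex_bij_witness[where i = "\<lambda>v. d - v" and j = "\<lambda>v. d - v"]) auto
  also have "\<dots> = (d + card (insert k S)) choose card (insert k S)"
    unfolding card_insert_disjoint[OF insert.hyps] by (rule sum_choose_const)
  finally show ?case .
qed

lemma card_exps: "card (exps d :: ('n::finite \<Rightarrow> nat) set) = (d + CARD('n)) choose CARD('n)"
  using card_exps_support[of "UNIV :: 'n set" d] by simp

lemma mev_hasse_diff:
  assumes "bounded_deg d c" "bounded_deg d c'"
  shows "mev (hasse i (\<lambda>e. c e - c' e)) x = mev (hasse i c) x - mev (hasse i c') x"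
proof -
  have "bounded_deg d (\<lambda>e. c e - c' e)"
    unfolding bounded_deg_def
  proof safe
    fix e assume "c e - c' e \<noteq> 0"
    then have "c e \<noteq> 0 \<or> c' e \<noteq> 0" by auto
    then show "mdeg e \<le> d" using assms by (auto simp: bounded_deg_def)
  qed
  note bds = assms[THEN bounded_deg_hasse] bounded_deg_hasse[OF this]
  have "hasse i (\<lambda>e. c e - c' e) e = hasse i c e - hasse i c' e" for e
    by (simp add: hasse_def right_diff_distrib)
  then show ?thesis
    unfolding bds[THEN mev_bounded] by (simp add: left_diff_distrib sum_subtractf)
qed

text \<open>Over a finite field, counting replaces linear algebra: there are more polynomials than
  possible value tables, so two share a table and their difference vanishes as required.\<close>

lemma exists_vanishing:
  fixes K :: "('n::finite \<Rightarrow> 'a::{field,finite}) set"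
  assumes less: "card K * card (exps M :: ('n \<Rightarrow> nat) set) < card (exps D :: ('n \<Rightarrow> nat) set)"
  shows "\<exists>c. bounded_deg D c \<and> (\<exists>e. c e \<noteq> 0) \<and> (\<forall>x\<in>K. vanishes (Suc M) c x)"
proof -
  let ?C = "PiE (exps D :: ('n \<Rightarrow> nat) set) (\<lambda>_. UNIV :: 'a set)"
  let ?V = "PiE (K \<times> (exps M :: ('n \<Rightarrow> nat) set)) (\<lambda>_. UNIV :: 'a set)"
  define c where "c = (\<lambda>f (e :: 'n \<Rightarrow> nat). if e \<in> exps D then f e else (0::'a))"
  \<comment> \<open>The table of all derivatives of order at most \<open>M\<close> at the points of
    \<open>K\<close>; agreement of tables means vanishing to order \<open>Suc M\<close>.\<close>
  define \<Phi> where "\<Phi> = (\<lambda>f. restrict (\<lambda>(x, i). mev (hasse i (c f)) x) (K \<times> exps M))"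
  have bd: "bounded_deg D (c f)" for f
    by (auto simp: bounded_deg_def c_def exps_def)
  have "2 \<le> CARD('a)"
    using card_mono[of UNIV "{0, 1 :: 'a}"] by simp
  then have "card ?V < card ?C"
    using less by (simp add: card_PiE card_cartesian_product)
  moreover have "card (\<Phi> ` ?C) \<le> card ?V"
    by (rule card_mono) (auto intro!: finite_PiE simp: \<Phi>_def split: if_splits)
  ultimately have "\<not> inj_on \<Phi> ?C"
    by (intro pigeonhole) simp
  then obtain f f' where ff: "f \<in> ?C" "f' \<in> ?C" "f \<noteq> f'" "\<Phi> f = \<Phi> f'"
    by (auto simp: inj_on_def)
  define h where "h = (\<lambda>e. c f e - c f' e)"
  obtain e where "e \<in> exps D" "f e \<noteq> f' e"
    using ff(1-3) by (metis PiE_ext)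
  then have "h e \<noteq> 0" by (simp add: h_def c_def)
  moreover have "bounded_deg D h"
    by (auto simp: bounded_deg_def h_def c_def exps_def)
  moreover have "vanishes (Suc M) h x" if "x \<in> K" for x
    unfolding vanishes_def
  proof safe
    fix i :: "'n \<Rightarrow> nat" assume "mdeg i < Suc M"
    then have "mev (hasse i (c f)) x = mev (hasse i (c f')) x"
      using fun_cong[OF ff(4), of "(x, i)"] that by (simp add: \<Phi>_def exps_def)
    then show "mev (hasse i h) x = 0"
      unfolding h_def by (simp add: mev_hasse_diff[OF bd bd])
  qed
  ultimately show ?thesis by blast
qed

section \<open>Leading coefficients along a curve\<close>

text \<open>The bounds \<open>a\<close> and \<open>b\<close> need not be attained, so the rule also
  covers coordinates of a curve whose quadratic coefficient is zero.\<close>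

lemma coeff_mult_degree_le:
  assumes "degree p \<le> a" "degree q \<le> b"
  shows "degree (p * q) \<le> a + b" "coeff (p * q) (a + b) = coeff p a * coeff q b"
proof -
  show "degree (p * q) \<le> a + b"
    using degree_mult_le[of p q] assms by simp
  have "(\<Sum>i\<le>a + b. coeff p i * coeff q (a + b - i)) = (\<Sum>i\<in>{a}. coeff p i * coeff q (a + b - i))"
  proof (rule sum.mono_neutral_right)
    show "\<forall>i\<in>{..a + b} - {a}. coeff p i * coeff q (a + b - i) = 0"
    proof
      fix i assume "i \<in> {..a + b} - {a}"
      then have "degree p < i \<or> degree q < a + b - i" using assms by auto
      then show "coeff p i * coeff q (a + b - i) = 0" by (auto simp: coeff_eq_0)
    qed
  qed auto
  then show "coeff (p * q) (a + b) = coeff p a * coeff q b"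
    by (simp add: coeff_mult)
qed

lemma coeff_power_degree_le:
  assumes "degree p \<le> a"
  shows "degree (p ^ k) \<le> a * k \<and> coeff (p ^ k) (a * k) = coeff p a ^ k"
proof (induction k)
  case (Suc k)
  then show ?case
    using coeff_mult_degree_le[OF assms, of "p ^ k" "a * k"] by simp
qed auto

lemma coeff_mon_degree_le:
  assumes "\<And>j. degree (g j) \<le> a"
  shows "degree (mon g e) \<le> a * mdeg e \<and> coeff (mon g e) (a * mdeg e) = mon (\<lambda>j. coeff (g j) a) e"
proof -
  have "degree (\<Prod>j\<in>A. g j ^ e j) \<le> a * (\<Sum>j\<in>A. e j) \<and>
      coeff (\<Prod>j\<in>A. g j ^ e j) (a * (\<Sum>j\<in>A. e j)) = (\<Prod>j\<in>A. coeff (g j) a ^ e j)" for A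
  proof (induction A rule: infinite_finite_induct)
    case (insert k A)
    then show ?case
      using coeff_power_degree_le[OF assms, of k "e k"]
        coeff_mult_degree_le[of "g k ^ e k" "a * e k" "\<Prod>j\<in>A. g j ^ e j" "a * (\<Sum>j\<in>A. e j)"]
      by (simp add: distrib_left)
  qed auto
  then show ?thesis by (simp add: mon_def mdeg_def)
qed

text \<open>A monomial of degree \<open>mdeg e\<close> contributes degree at most
  \<open>(d - mdeg e) + 2 * mdeg e = d + mdeg e\<close>. Only the leading form reaches
  \<open>2 * d\<close>, and there it sees just the quadratic coefficients of the curve.\<close>

lemma top_form_homog_comp:
  fixes c :: "('n::finite \<Rightarrow> nat) \<Rightarrow> 'a::comm_ring_1"
  assumes "bounded_deg d c" "degree z \<le> 1" "\<And>j. degree (g j) \<le> 2"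
  shows "degree (homog_comp d c z g) \<le> 2 * d"
    and "coeff (homog_comp d c z g) (2 * d) = mev (top_form d c) (\<lambda>j. coeff (g j) 2)"
proof -
  have deg: "degree (z ^ (d - mdeg e) * mon g e) \<le> d - mdeg e + 2 * mdeg e" for e
    using coeff_power_degree_le[OF assms(2), of "d - mdeg e"] coeff_mon_degree_le[of g 2 e, OF assms(3)]
    by (intro coeff_mult_degree_le(1)) auto
  show "degree (homog_comp d c z g) \<le> 2 * d"
    unfolding homog_comp_def
  proof (rule degree_sum_le)
    fix e :: "'n \<Rightarrow> nat" assume "e \<in> exps d"
    then show "degree (smult (c e) (z ^ (d - mdeg e) * mon g e)) \<le> 2 * d"
      using deg[of e] by (intro order_trans[OF degree_smult_le]) (simp add: exps_def)
  qed simp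
  have "coeff (homog_comp d c z g) (2 * d) =
      (\<Sum>e\<in>exps d. c e * coeff (z ^ (d - mdeg e) * mon g e) (2 * d))"
    by (simp add: homog_comp_def coeff_sum)
  also have "\<dots> = (\<Sum>e\<in>exps d. top_form d c e * mon (\<lambda>j. coeff (g j) 2) e)"
  proof (rule sum.cong[OF refl])
    fix e :: "'n \<Rightarrow> nat" assume e: "e \<in> exps d"
    show "c e * coeff (z ^ (d - mdeg e) * mon g e) (2 * d) =
        top_form d c e * mon (\<lambda>j. coeff (g j) 2) e"
    proof (cases "mdeg e = d")
      case True
      then show ?thesis
        using coeff_mon_degree_le[of g 2 e, OF assms(3)] by (simp add: top_form_def)
    next
      case False
      then have "degree (z ^ (d - mdeg e) * mon g e) < 2 * d"
        using deg[of e] e by (simp add: exps_def)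
      then show ?thesis using False by (simp add: coeff_eq_0 top_form_def)
    qed
  qed
  also have "\<dots> = mev (top_form d c) (\<lambda>j. coeff (g j) 2)"
    by (simp add: mev_bounded[OF bounded_deg_top_form])
  finally show "coeff (homog_comp d c z g) (2 * d) = mev (top_form d c) (\<lambda>j. coeff (g j) 2)" .
qed

text \<open>A Hasse derivative lowers the degree of each surviving monomial by exactly
  \<open>mdeg i\<close>; the hypothesis keeps the truncated subtraction exact.\<close>

lemma hasse_top_form:
  fixes i :: "'n::finite \<Rightarrow> nat"
  assumes "mdeg i \<le> d"
  shows "hasse i (top_form d c) = top_form (d - mdeg i) (hasse i c)"
proof
  fix e :: "'n \<Rightarrow> nat"
  have "mdeg e + mdeg i = d \<longleftrightarrow> mdeg e = d - mdeg i" using assms by auto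
  then show "hasse i (top_form d c) e = top_form (d - mdeg i) (hasse i c) e"
    by (simp add: hasse_def top_form_def mdeg_add)
qed

lemma top_form_eq_0:
  fixes c :: "('n::finite \<Rightarrow> nat) \<Rightarrow> 'a::field"
  assumes "bounded_deg d c" "degree z \<le> 1" "\<And>j. degree (g j) \<le> 2" "finite T"
    and "\<And>t. t \<in> T \<Longrightarrow> poly z t \<noteq> 0"
    and "\<And>t. t \<in> T \<Longrightarrow> vanishes m c (\<lambda>j. poly (g j) t / poly z t)"
    and "2 * d < m * card T"
  shows "mev (top_form d c) (\<lambda>j. coeff (g j) 2) = 0"
proof -
  have "homog_comp d c z g = 0"
    using top_form_homog_comp(1)[of d c z g, OF assms(1-3)] assms(7)
    by (intro homog_comp_eq_0[OF assms(1,4,5,6)]) auto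
  then show ?thesis
    using top_form_homog_comp(2)[of d c z g, OF assms(1-3)] by simp
qed

section \<open>Conics as rational curves and the bound for each multiplicity\<close>

text \<open>Both kinds of conic become curves \<open>g / z\<close> with quadratic coefficient
  \<open>v\<close>. Multiplying a hyperbola by \<open>t\<close> gives
  \<open>c + t a + t^2 b\<close>; excluding \<open>t = 0\<close> leaves \<open>CARD('a) - 1\<close>
  parameters.\<close>

lemma conical_Kakeya_set_curve:
  fixes K :: "('a::{field,finite} ^ 'n) set"
  assumes "conical_Kakeya_set K" "v \<noteq> 0"
  shows "\<exists>z g. \<exists>T :: 'a set. degree z \<le> 1 \<and> (\<forall>j. degree (g j) \<le> 2) \<and> (\<forall>j. coeff (g j) 2 = v $ j) \<and>
    CARD('a) - 1 \<le> card T \<and> (\<forall>t\<in>T. poly z t \<noteq> 0 \<and> (\<chi> j. poly (g j) t / poly z t) \<in> K)"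
proof -
  obtain a b c where
    "v \<in> {b, c} \<and> hyperbola a b c \<subseteq> K \<or> v = c \<and> parabola a b c \<subseteq> K"
    using assms unfolding conical_Kakeya_set_def by metis
  then consider "v = b" "hyperbola a b c \<subseteq> K" | "v = c" "hyperbola a b c \<subseteq> K"
    | "v = c" "parabola a b c \<subseteq> K"
    by auto
  then show ?thesis
  proof cases
    case 1
    have "(\<chi> j. poly [:c $ j, a $ j, b $ j:] t / poly [:0, 1:] t) = a + t *s b + inverse t *s c"
      if "t \<noteq> 0" for t
      using that by (simp add: vec_eq_iff field_simps)
    moreover have "a + t *s b + inverse t *s c \<in> K" if "t \<noteq> 0" for t
      using 1 that by (auto simp: hyperbola_def)
    ultimately show ?thesis
      by (intro exI[of _ "[:0, 1:]"] exI[of _ "\<lambda>j. [:c $ j, a $ j, b $ j:]"] exI[of _ "UNIV - {0}"])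
        (auto simp: 1 card_Diff_singleton numeral_2_eq_2)
  next
    case 2
    \<comment> \<open>Replacing \<open>t\<close> by its inverse swaps the roles of \<open>b\<close>
      and \<open>c\<close>, so that \<open>c\<close> becomes the quadratic coefficient.\<close>
    have "(\<chi> j. poly [:b $ j, a $ j, c $ j:] t / poly [:0, 1:] t) =
        a + inverse t *s b + inverse (inverse t) *s c"
      if "t \<noteq> 0" for t
      using that by (simp add: vec_eq_iff field_simps)
    moreover have "a + inverse t *s b + inverse (inverse t) *s c \<in> K" if "t \<noteq> 0" for t
    proof -
      have "inverse t \<noteq> 0" using that by simp
      then show ?thesis using 2 unfolding hyperbola_def by blast
    qed
    ultimately show ?thesis
      by (intro exI[of _ "[:0, 1:]"] exI[of _ "\<lambda>j. [:b $ j, a $ j, c $ j:]"] exI[of _ "UNIV - {0}"])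
        (auto simp: 2 card_Diff_singleton numeral_2_eq_2)
  next
    case 3
    have "(\<chi> j. poly [:a $ j, b $ j, c $ j:] t / poly 1 t) = a + t *s b + t\<^sup>2 *s c" for t
      by (simp add: vec_eq_iff algebra_simps power2_eq_square)
    moreover have "a + t *s b + t\<^sup>2 *s c \<in> K" for t
      using 3 by (auto simp: parabola_def)
    ultimately show ?thesis
      by (intro exI[of _ 1] exI[of _ "\<lambda>j. [:a $ j, b $ j, c $ j:]"] exI[of _ UNIV])
        (auto simp: 3 numeral_2_eq_2)
  qed
qed

text \<open>The left side is below \<open>2 * l * q - 2 * w\<close>, and the right side exceeds that
  number by exactly \<open>(l - w) * (q - 3)\<close>. This is why multiplicity \<open>3 * l\<close>
  is chosen and where \<open>3 \<le> q\<close> enters.\<close>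

lemma degree_multiplicity_bound:
  fixes q l d w :: nat
  assumes "3 \<le> q" "d < l * q" "w < l" "w \<le> d"
  shows "2 * (d - w) < (3 * l - w) * (q - 1)"
proof -
  \<comment> \<open>Slack variables remove the truncated subtractions.\<close>
  obtain r where r: "q = r + 3" using assms(1) by (metis le_add_diff_inverse2)
  obtain u where u: "l = w + 1 + u" using assms(3) by (metis Suc_eq_plus1 less_iff_Suc_add add_Suc)
  obtain y where y: "d = w + y" using assms(4) le_Suc_ex by blast
  have "3 * l - w = 2 * w + 3 + 3 * u" "q - 1 = r + 2" "d - w = y" using r u y by auto
  moreover have "w + y < (w + 1 + u) * (r + 3)" using assms(2) r u y by simp
  ultimately show ?thesis by (simp add: algebra_simps)
qed

lemma conical_Kakeya_multiplicity_bound: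
  fixes K :: "('a::{field,finite} ^ 'n) set"
  assumes K: "conical_Kakeya_set K" and q: "3 \<le> CARD('a)" and l: "0 < l"
  shows "card (exps (l * CARD('a) - 1) :: ('n \<Rightarrow> nat) set)
    \<le> card K * card (exps (3 * l - 1) :: ('n \<Rightarrow> nat) set)"
proof (rule ccontr)
  let ?q = "CARD('a)"
  assume neg: "\<not> ?thesis"
  have "card ((\<lambda>x j. x $ j) ` K) = card K"
    by (rule card_image) (auto simp: inj_on_def vec_eq_iff fun_eq_iff)
  with neg obtain c :: "('n \<Rightarrow> nat) \<Rightarrow> 'a" where c: "bounded_deg (l * ?q - 1) c" "\<exists>e. c e \<noteq> 0"
    "\<And>x. x \<in> K \<Longrightarrow> vanishes (Suc (3 * l - 1)) c (\<lambda>j. x $ j)"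
    using exists_vanishing[of "(\<lambda>x j. x $ j) ` K" "3 * l - 1" "l * ?q - 1"] by auto
  have van: "vanishes (3 * l) c (\<lambda>j. x $ j)" if "x \<in> K" for x
    using c(3)[OF that] l by simp
  let ?E = "{e. c e \<noteq> 0}"
  have "finite ?E"
    by (rule finite_subset[OF _ finite_exps[of "l * ?q - 1"]])
      (use c(1) in \<open>auto simp: bounded_deg_def exps_def\<close>)
  \<comment> \<open>The exact degree of \<open>c\<close>, rather than the bound
    \<open>l * ?q - 1\<close>, so that the leading form is nonzero.\<close>
  define d where "d = Max (mdeg ` ?E)"
  have bd: "bounded_deg d c"
    unfolding bounded_deg_def d_def using \<open>finite ?E\<close> by (auto intro: Max_ge)
  have "d \<in> mdeg ` ?E"
    unfolding d_def by (rule Max_in) (use \<open>finite ?E\<close> c(2) in auto)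
  then obtain e0 where e0: "c e0 \<noteq> 0" "mdeg e0 = d" by auto
  have "d \<le> l * ?q - 1" using e0 c(1) by (auto simp: bounded_deg_def)
  moreover have "0 < l * ?q" using l q by simp
  ultimately have d: "d < l * ?q" by linarith
  have "\<exists>e. top_form d c e \<noteq> 0" using e0 by (auto simp: top_form_def)
  then obtain x i where xi: "mev (hasse i (top_form d c)) x \<noteq> 0" "?q * mdeg i \<le> d"
    using schwartz_zippel_multiplicity[OF finite_class.finite_UNIV bounded_deg_top_form[of d c]] by auto
  have "?q * mdeg i < ?q * l"
    using xi(2) d unfolding mult.commute[of l] by (rule le_less_trans)
  then have il: "mdeg i < l" by simp
  have "mdeg i \<le> ?q * mdeg i" using q by simp
  then have id: "mdeg i \<le> d" using xi(2) by (rule order_trans)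
  \<comment> \<open>A derivative of the leading form is the leading form of a derivative, which is
    what restriction to a conic detects.\<close>
  define f where "f = top_form (d - mdeg i) (hasse i c)"
  have f: "mev f x \<noteq> 0" using xi(1) id by (simp add: hasse_top_form f_def)
  \<comment> \<open>Directions are nonzero; a form that does not vanish at the origin is constant.\<close>
  have "\<exists>v. v \<noteq> 0 \<and> mev f (\<lambda>j. v $ j) \<noteq> 0"
  proof (cases "x = (\<lambda>_. 0)")
    case False
    then have "(\<chi> j. x j) \<noteq> 0" by (auto simp: vec_eq_iff)
    then show ?thesis using f by (intro exI[of _ "\<chi> j. x j"]) simp
  next
    case True
    have "d - mdeg i = 0"
    proof (rule ccontr)
      assume "d - mdeg i \<noteq> 0"
      have "f e * mon x e = 0" for e
      proof (cases "f e = 0")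
        case False
        then have "mdeg e = d - mdeg i" by (auto simp: f_def top_form_def split: if_splits)
        then have "mdeg e \<noteq> 0" using \<open>d - mdeg i \<noteq> 0\<close> by simp
        then obtain j where "e j \<noteq> 0" by (auto simp: mdeg_def)
        then have "mon x e = 0" using True by (auto simp: mon_def)
        then show ?thesis by simp
      qed simp
      then have "mev f x = 0" unfolding mev_def by (intro sum.neutral) blast
      then show False using f by simp
    qed
    then have "bounded_deg 0 f" using bounded_deg_top_form[of "d - mdeg i"] by (simp add: f_def)
    moreover have "exps 0 = {\<lambda>_::'n. 0}" by (auto simp: exps_def mdeg_eq_0_iff)
    ultimately have "mev f y = f (\<lambda>_. 0)" for y by (simp add: mev_bounded mon_def)
    \<comment> \<open>As \<open>f\<close> is constant here, any nonzero vector serves; the all-ones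
      vector is taken.\<close>
    then show ?thesis using f by (intro exI[of _ "\<chi> j. 1"]) (auto simp: vec_eq_iff)
  qed
  then obtain v where v: "v \<noteq> 0" "mev f (\<lambda>j. v $ j) \<noteq> 0" by blast
  obtain z g and T :: "'a set" where curve: "degree z \<le> 1" "\<And>j. degree (g j) \<le> 2"
    "\<And>j. coeff (g j) 2 = v $ j" "?q - 1 \<le> card T"
    "\<And>t. t \<in> T \<Longrightarrow> poly z t \<noteq> 0" "\<And>t. t \<in> T \<Longrightarrow> (\<chi> j. poly (g j) t / poly z t) \<in> K"
    using conical_Kakeya_set_curve[OF K v(1)] by blast
  have "mev f (\<lambda>j. coeff (g j) 2) = 0"
    unfolding f_def
  proof (rule top_form_eq_0[OF bounded_deg_hasse[OF bd] curve(1,2) _ curve(5)])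
    show "vanishes (3 * l - mdeg i) (hasse i c) (\<lambda>j. poly (g j) t / poly z t)" if "t \<in> T" for t
      using vanishes_hasse[OF bd van[OF curve(6)[OF that]], of i] by simp
    have "2 * (d - mdeg i) < (3 * l - mdeg i) * (?q - 1)"
      by (rule degree_multiplicity_bound[OF q d il id])
    also have "\<dots> \<le> (3 * l - mdeg i) * card T" by (intro mult_le_mono2 curve(4))
    finally show "2 * (d - mdeg i) < (3 * l - mdeg i) * card T" .
  qed auto
  then show False using v(2) curve(3) by simp
qed

section \<open>Passage to the limit\<close>

text \<open>The right side is the product \<open>(N + 1) ... (N + n)\<close>, each of whose
  \<open>n\<close> factors is at least \<open>N + 1\<close>.\<close>

lemma power_le_fact_mult_binomial: "Suc N ^ n \<le> fact n * ((N + n) choose n)"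
proof (induction n)
  case (Suc n)
  have "Suc N ^ Suc n \<le> Suc (N + n) * (fact n * ((N + n) choose n))"
    unfolding power_Suc by (intro mult_mono Suc) auto
  also have "\<dots> = fact n * (Suc (N + n) * ((N + n) choose n))" by (simp only: mult_ac)
  also have "Suc (N + n) * ((N + n) choose n) = Suc n * (Suc (N + n) choose Suc n)"
    by (rule Suc_times_binomial[symmetric])
  also have "fact n * (Suc n * (Suc (N + n) choose Suc n)) = fact (Suc n) * ((N + Suc n) choose Suc n)"
    by (simp only: fact_Suc of_nat_id mult_ac add_Suc_right)
  finally show ?case .
qed simp

theorem theorem3:
  fixes K :: "('a::{field,finite} ^ 'n) set" and p k q :: nat
  assumes "prime p" and "odd p" and "k \<ge> 1" and "q = p ^ k"
    and "CARD('a) = q"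
    and "CARD('n) \<ge> 2"
    and "conical_Kakeya_set K"
  shows "real (card K) \<ge> (real q / 3) ^ CARD('n)"
proof -
  let ?n = "CARD('n)"
  have "p \<noteq> 2" "2 \<le> p" using assms(1,2) prime_ge_2_nat by auto
  then have "3 \<le> p" by simp
  also have "p \<le> p ^ k" using assms(3) \<open>3 \<le> p\<close> by (intro self_le_power) auto
  finally have q: "3 \<le> q" using assms(4) by simp
  \<comment> \<open>Both binomials are compared with \<open>n\<close>-th powers, giving
    \<open>(l * q) ^ n\<close> at most \<open>card K * (3 * l + n) ^ n\<close>; division by
    \<open>l ^ n\<close> isolates the error \<open>n / l\<close>.\<close>
  have bound: "real q ^ ?n \<le> real (card K) * (3 + real ?n / real l) ^ ?n" if "0 < l" for l
  proof -
    have "0 < l * q" using that q by simp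
    then have "(l * q) ^ ?n \<le> fact ?n * ((l * q - 1 + ?n) choose ?n)"
      using power_le_fact_mult_binomial[of "l * q - 1" ?n] by simp
    also have "\<dots> \<le> fact ?n * (card K * ((3 * l - 1 + ?n) choose ?n))"
      using conical_Kakeya_multiplicity_bound[OF assms(7) _ that] q
      by (intro mult_le_mono2) (simp add: card_exps assms(5))
    also have "\<dots> = card K * (((3 * l - 1 + ?n) choose ?n) * fact ?n)" by simp
    also have "\<dots> \<le> card K * (3 * l - 1 + ?n) ^ ?n"
      by (intro mult_le_mono2 binomial_fact_pow)
    also have "\<dots> \<le> card K * (3 * l + ?n) ^ ?n" by (intro mult_le_mono2 power_mono) auto
    finally have "real ((l * q) ^ ?n) \<le> real (card K * (3 * l + ?n) ^ ?n)"
      by (simp only: of_nat_le_iff)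
    then have "real l ^ ?n * real q ^ ?n \<le> real (card K) * (3 * real l + real ?n) ^ ?n"
      by (simp add: power_mult_distrib)
    also have "3 * real l + real ?n = real l * (3 + real ?n / real l)"
      using that by (simp add: field_simps)
    finally show ?thesis
      using that by (simp add: power_mult_distrib mult.left_commute)
  qed
  \<comment> \<open>The set \<open>K\<close> is fixed while \<open>l\<close> grows, so the error
    term disappears in the limit.\<close>
  have "(\<lambda>l. real (card K) * (3 + real ?n / real l) ^ ?n) \<longlonglongrightarrow> real (card K) * (3 + 0) ^ ?n"
    by (intro tendsto_intros lim_const_over_n)
  then have "real q ^ ?n \<le> real (card K) * (3 + 0) ^ ?n"
    by (rule tendsto_lowerbound) (use bound in \<open>auto simp: eventually_sequentially intro!: exI[of _ 1]\<close>)
  then show ?thesis by (simp add: power_divide field_simps)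
qed

end
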